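(* Let $S$ be a smooth closed strictly convex hypersurface in the Euclidean space $\mathbb{R}^n$, $n\ge 2$. Assume that $S$ admits a non-vanishing normal vector field $N$ such that for all points $x,y\in S$ one has $$ N(x)\cdot (y-x) = -N(y)\cdot (y-x). $$ Then $S$ is an ellipsoid.
   Context: The dot denotes the Euclidean scalar product. A normal vector field along $S$ assigns to each $x\in S$ a vector $N(x)\in\mathbb{R}^n$ orthogonal to the tangent hyperplane $T_xS$; it is not assumed to have unit length. "Closed strictly convex hypersurface" means the boundary of a compact strictly convex body (the boundary of a billiard table). *)

theory Defs
  imports "HOL-Analysis.Analysis"
begin

text \<open>
  \<open>Ck_on k f U\<close> says that \<open>f\<close> is of class $C^k$ on \<open>U\<close>. It is meant for open sets \<open>U\<close> only;
  for the passage from \<open>k\<close> to \<open>k + 1\<close> it asks that \<open>f\<close> is differentiable and that all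
  directional derivatives of \<open>f\<close> are of class $C^k$.
\<close>

fun Ck_on :: "nat \<Rightarrow> ('a::euclidean_space \<Rightarrow> 'b::real_normed_vector) \<Rightarrow> 'a set \<Rightarrow> bool" where
  "Ck_on 0 f U \<longleftrightarrow> continuous_on U f"
| "Ck_on (Suc k) f U \<longleftrightarrow>
     (\<forall>x\<in>U. f differentiable (at x)) \<and>
     (\<forall>v. Ck_on k (\<lambda>x. frechet_derivative f (at x) v) U)"

definition smooth_on :: "('a::euclidean_space \<Rightarrow> 'b::real_normed_vector) \<Rightarrow> 'a set \<Rightarrow> bool" where
  "smooth_on f U \<longleftrightarrow> (\<forall>k. Ck_on k f U)"

definition local_defining_function ::
  "'a::euclidean_space set \<Rightarrow> 'a \<Rightarrow> 'a set \<Rightarrow> ('a \<Rightarrow> real) \<Rightarrow> bool" where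
  "local_defining_function S p U f \<longleftrightarrow>
     open U \<and> p \<in> U \<and> smooth_on f U \<and>
     S \<inter> U = {x \<in> U. f x = 0} \<and>
     (\<forall>x \<in> S \<inter> U. \<exists>v. frechet_derivative f (at x) v \<noteq> 0)"

definition smooth_hypersurface :: "'a::euclidean_space set \<Rightarrow> bool" where
  "smooth_hypersurface S \<longleftrightarrow> (\<forall>p\<in>S. \<exists>U f. local_defining_function S p U f)"

text \<open>
  The tangent hyperplane as a linear subspace: the kernel of the differential at \<open>p\<close> of a local
  defining function. For \<open>p \<in> S\<close> this kernel is the same for all local defining functions, so
  that the existential quantifier below does not enlarge it.
\<close>

definition tangent_hyperplane :: "'a::euclidean_space set \<Rightarrow> 'a \<Rightarrow> 'a set" where
  "tangent_hyperplane S p =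
     {v. \<exists>U f. local_defining_function S p U f \<and> frechet_derivative f (at p) v = 0}"

definition normal_field_along ::
  "'a::euclidean_space set \<Rightarrow> ('a \<Rightarrow> 'a) \<Rightarrow> bool" where
  "normal_field_along S N \<longleftrightarrow> (\<forall>x\<in>S. \<forall>v\<in>tangent_hyperplane S x. N x \<bullet> v = 0)"

definition strictly_convex_body :: "'a::euclidean_space set \<Rightarrow> bool" where
  "strictly_convex_body K \<longleftrightarrow>
     compact K \<and> interior K \<noteq> {} \<and>
     (\<forall>x\<in>K. \<forall>y\<in>K. x \<noteq> y \<longrightarrow> open_segment x y \<subseteq> interior K)"

definition closed_strictly_convex_hypersurface :: "'a::euclidean_space set \<Rightarrow> bool" where
  "closed_strictly_convex_hypersurface S \<longleftrightarrow>
     (\<exists>K. strictly_convex_body K \<and> S = frontier K)"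

text \<open>
  An ellipsoid is the surface, not the solid body, with arbitrary centre and axes:
  the quadric given by a symmetric positive definite matrix.
\<close>

definition is_ellipsoid :: "(real ^ 'n) set \<Rightarrow> bool" where
  "is_ellipsoid E \<longleftrightarrow>
     (\<exists>(A :: real ^ 'n ^ 'n) c.
        transpose A = A \<and> (\<forall>v. v \<noteq> 0 \<longrightarrow> v \<bullet> (A *v v) > 0) \<and>
        E = {x. (x - c) \<bullet> (A *v (x - c)) = 1})"

end

theory Submission
  imports Defs
begin

text \<open>
  The hypothesis reads \<open>N x \<bullet> (y - x) = N y \<bullet> (x - y)\<close>: the height of \<open>y\<close> over the tangent
  hyperplane at \<open>x\<close>, measured with \<open>N x\<close>, is symmetric in \<open>x\<close> and \<open>y\<close>. Lifting \<open>x\<close> to \<open>(x, 1)\<close>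
  makes this height linear: it is the inner product of \<open>(N x, - (N x \<bullet> x))\<close> with \<open>(y, 1)\<close>. A
  symmetric pairing of this form on a spanning set forces the map
  \<open>(x, 1) \<mapsto> (N x, - (N x \<bullet> x))\<close> to be the restriction of a self-adjoint linear map \<open>A\<close>
  (lemma \<open>symmetric_pairing_extends\<close>), and the lifted points of \<open>S\<close> do span because \<open>S\<close> bounds a
  region and so lies in no hyperplane (lemma \<open>span_lifted_frontier\<close>). The height of \<open>x\<close> over
  the tangent hyperplane at \<open>x\<close> is \<open>0\<close>, so \<open>S\<close> lies on the quadric
  \<open>A (x, 1) \<bullet> (x, 1) = 0\<close>.

  Every line through an interior point \<open>p\<close> of the body meets \<open>S\<close> on both sides of \<open>p\<close>. If \<open>p\<close>
  itself were on the quadric, each of these lines would contain three of its points, so the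
  quadric would be the whole space; this is impossible because \<open>2 * N\<close> is its gradient along \<open>S\<close>
  and does not vanish. Hence the polynomial restricted to each line has exactly the two roots on
  either side of \<open>p\<close>. Their product is negative, which makes the quadratic part definite, and
  since each ray from \<open>p\<close> contains only one point of the quadric, that point belongs to \<open>S\<close>
  (lemma \<open>frontier_in_quadric\<close>). Completing the square gives the ellipsoid (lemma
  \<open>definite_quadric_eq_ellipsoid\<close>).
\<close>

section \<open>Symmetric pairings are linear\<close>

lemma span_eq_UNIV_if_orthogonal_trivial:
  fixes T :: "'a::euclidean_space set"
  assumes "\<And>w. (\<And>x. x \<in> T \<Longrightarrow> w \<bullet> x = 0) \<Longrightarrow> w = 0"
  shows "span T = UNIV"
proof (rule ccontr)
  assume "span T \<noteq> UNIV"
  then have "dim T < DIM('a)"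
    using dim_eq_full dim_subset_UNIV le_neq_implies_less by blast
  then obtain w where "w \<noteq> 0" and w: "\<And>x. x \<in> span T \<Longrightarrow> orthogonal w x"
    using orthogonal_to_subspace_exists by metis
  then show False
    using assms[of w] span_base unfolding orthogonal_def by blast
qed

text \<open>
  A vector is determined by its inner products with a basis \<open>B \<subseteq> T\<close>, and symmetry turns
  \<open>M x \<bullet> b\<close> into \<open>M b \<bullet> x\<close>, which is linear in \<open>x\<close>. So \<open>M\<close> has no freedom beyond its values on \<open>B\<close>.
\<close>

lemma symmetric_pairing_extends:
  fixes M :: "'a::euclidean_space \<Rightarrow> 'a"
  assumes spanning: "span T = UNIV"
    and sym: "\<And>x y. x \<in> T \<Longrightarrow> y \<in> T \<Longrightarrow> M x \<bullet> y = M y \<bullet> x"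
  obtains A where "linear A" "\<And>x y. A x \<bullet> y = A y \<bullet> x" "\<And>x. x \<in> T \<Longrightarrow> A x = M x"
proof -
  obtain B where B: "B \<subseteq> T" "independent B" "T \<subseteq> span B"
    using maximal_independent_subset by blast
  have B_span: "x \<in> span B" for x
    using B(3) spanning span_mono span_span by (metis UNIV_I subsetD)
  obtain A where A: "linear A" and AB: "\<And>b. b \<in> B \<Longrightarrow> A b = M b"
    using linear_independent_extend[OF B(2)] by blast
  have zero: "w = 0" if "\<And>b. b \<in> B \<Longrightarrow> w \<bullet> b = 0" for w
    using orthogonal_to_span[OF B_span, of w w] that by (simp add: orthogonal_def)
  have sym_B: "A x \<bullet> b = A b \<bullet> x" if "b \<in> B" for x b
    using B_span[of x]
  proof (induction rule: span_induct_alt)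
    case base
    then show ?case by (simp add: linear_0[OF A])
  next
    case (step c b' y)
    have "A b' \<bullet> b = A b \<bullet> b'"
      using sym that step(1) B(1) AB by (metis subsetD)
    then show ?case
      using step by (simp add: linear_add[OF A] linear_scale[OF A] inner_add_left inner_add_right)
  qed
  have sym_A: "A x \<bullet> y = A y \<bullet> x" for x y
    using B_span[of y]
  proof (induction rule: span_induct_alt)
    case base
    then show ?case by (simp add: linear_0[OF A])
  next
    case (step c b y)
    then show ?case
      using sym_B[of b x]
      by (simp add: linear_add[OF A] linear_scale[OF A] inner_add_left inner_add_right)
  qed
  have "A x = M x" if "x \<in> T" for x
  proof -
    have "(A x - M x) \<bullet> b = 0" if "b \<in> B" for b
      using sym_A[of x b] sym[of x b] AB[OF that] \<open>x \<in> T\<close> that B(1)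
      by (auto simp: inner_diff_left)
    then show ?thesis using zero[of "A x - M x"] by simp
  qed
  then show ?thesis using that A sym_A by blast
qed

section \<open>Frontiers of bounded sets that lie on a quadric\<close>

lemma span_lifted_frontier:
  fixes K :: "'a::euclidean_space set"
  assumes "bounded K" "p \<in> interior K"
  shows "span ((\<lambda>x. (x, 1::real)) ` frontier K) = UNIV"
proof (rule span_eq_UNIV_if_orthogonal_trivial)
  fix w :: "'a \<times> real"
  assume orth: "\<And>x. x \<in> (\<lambda>x. (x, 1)) ` frontier K \<Longrightarrow> w \<bullet> x = 0"
  have zero: "fst w \<bullet> x + snd w = 0" if "x \<in> frontier K" for x
    using orth[of "(x, 1)"] that by (simp add: inner_prod_def)
  have fst0: "fst w = 0"
  proof (rule ccontr)
    assume nz: "fst w \<noteq> 0"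
    obtain d where d: "0 < d" "p + d *\<^sub>R fst w \<in> frontier K"
      using ray_to_frontier[OF assms nz] by blast
    obtain e where e: "0 < e" "p + e *\<^sub>R (- fst w) \<in> frontier K"
      using ray_to_frontier[OF assms, of "- fst w"] nz by (metis neg_equal_0_iff_equal)
    have "(d + e) * (fst w \<bullet> fst w) = 0"
      using zero[OF d(2)] zero[OF e(2)] by (simp add: inner_add_right inner_diff_right algebra_simps)
    then show False using d(1) e(1) nz by simp
  qed
  obtain b :: 'a where "b \<in> Basis" using nonempty_Basis by blast
  then have "b \<noteq> 0" by (rule nonzero_Basis)
  then obtain x where "x \<in> frontier K"
    using ray_to_frontier[OF assms] by metis
  then show "w = 0" using zero fst0 by (simp add: prod_eq_iff)
qed

text \<open>
  The quadric is \<open>{x. A (x, 1) \<bullet> (x, 1) = 0}\<close>; its gradient at \<open>x\<close> is \<open>2 * fst (A (x, 1))\<close>, so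
  the last assumption excludes the quadric that is the whole space. The number
  \<open>A (u, 0) \<bullet> (u, 0)\<close> is the leading coefficient of the quadric along a line of direction \<open>u\<close>.
\<close>

lemma frontier_in_quadric:
  fixes K :: "'a::euclidean_space set" and A :: "'a \<times> real \<Rightarrow> 'a \<times> real"
  assumes K: "bounded K" "p \<in> interior K"
    and A: "linear A" and sym: "\<And>X Y. A X \<bullet> Y = A Y \<bullet> X"
    and quadric: "\<And>x. x \<in> frontier K \<Longrightarrow> A (x, 1) \<bullet> (x, 1) = 0"
    and nondeg: "fst (A (z, 1)) \<noteq> 0"
  shows "u \<noteq> 0 \<Longrightarrow> (A (u, 0) \<bullet> (u, 0)) * (A (p, 1) \<bullet> (p, 1)) < 0"
    and "frontier K = {x. A (x, 1) \<bullet> (x, 1) = 0}"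
proof -
  define q where "q = A (p, 1) \<bullet> (p, 1)"
  define lead where "lead u = A (u, 0) \<bullet> (u, 0)" for u
  define lin where "lin u = A (p, 1) \<bullet> (u, 0)" for u
  have on_line: "A (p + t *\<^sub>R u, 1) \<bullet> (p + t *\<^sub>R u, 1) = q + 2 * t * lin u + t\<^sup>2 * lead u" for t u
  proof -
    have X: "(p + t *\<^sub>R u, 1) = (p, 1) + t *\<^sub>R (u, 0)" by simp
    show ?thesis
      unfolding X linear_add[OF A] linear_scale[OF A] inner_add_left inner_add_right
        q_def lin_def lead_def
      using sym[of "(u, 0)" "(p, 1)"]
      by (simp only: inner_scaleR_left inner_scaleR_right) (simp add: power2_eq_square algebra_simps)
  qed
  have hit: "\<exists>t>0. p + t *\<^sub>R u \<in> frontier K \<and> q + 2 * t * lin u + t\<^sup>2 * lead u = 0"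
    if "u \<noteq> 0" for u
    using ray_to_frontier[OF K that] quadric on_line by metis
  have lin_minus: "lin (- u) = - lin u" and lead_minus: "lead (- u) = lead u" for u
    using linear_scale[OF A, of "-1" "(u, 0)"] by (simp_all add: lin_def lead_def inner_prod_def)
  \<comment> \<open>The roots \<open>t\<close> and \<open>- s\<close> on both sides of \<open>p\<close> give the values of both coefficients.\<close>
  have roots: "\<exists>t>0. \<exists>s>0. q = - (t * s * lead u) \<and> 2 * lin u = (s - t) * lead u"
    if u: "u \<noteq> 0" for u
  proof -
    obtain t where t: "t > 0" "q + 2 * t * lin u + t\<^sup>2 * lead u = 0"
      using hit[OF u] by blast
    obtain s where s: "s > 0" "q - 2 * s * lin u + s\<^sup>2 * lead u = 0"
      using hit[of "- u"] u lin_minus lead_minus by auto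
    have "(s + t) * (q + t * s * lead u) = 0"
      using t(2) s(2) by algebra
    then have q: "q = - (t * s * lead u)" using t(1) s(1) by simp
    have "t * (2 * lin u - (s - t) * lead u) = 0"
      using t(2) q by algebra
    then have "2 * lin u = (s - t) * lead u" using t(1) by simp
    then show ?thesis using q t(1) s(1) by blast
  qed
  \<comment> \<open>With \<open>p\<close> on the quadric as a third root, both coefficients vanish on every line through \<open>p\<close>.\<close>
  have q: "q \<noteq> 0"
  proof
    assume q0: "q = 0"
    have lead0: "lead u = 0" for u
      using roots[of u] q0 linear_0[OF A] by (cases "u = 0") (auto simp: lead_def zero_prod_def)
    have lin0: "lin u = 0" for u
      using roots[of u] lead0[of u] by (cases "u = 0") (auto simp: lin_def inner_prod_def)
    define v where "v = fst (A (z, 1))"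
    \<comment> \<open>Polarisation of \<open>lead = 0\<close>.\<close>
    have "lead (z - p + v) = lead (z - p) + 2 * (A (z - p, 0) \<bullet> (v, 0)) + lead v"
    proof -
      have X: "(z - p + v, 0) = (z - p, 0) + (v, 0::real)" by simp
      show ?thesis
        unfolding lead_def X linear_add[OF A] inner_add_left inner_add_right
        using sym[of "(v, 0)" "(z - p, 0)"] by simp
    qed
    then have "A (z - p, 0) \<bullet> (v, 0) = 0" using lead0 by simp
    moreover have "A (z, 1) = A (p, 1) + A (z - p, 0)"
      using linear_add[OF A, of "(p, 1)" "(z - p, 0)"] by simp
    ultimately have "A (z, 1) \<bullet> (v, 0) = 0"
      using lin0[of v] by (simp add: lin_def inner_add_left)
    then have "v \<bullet> v = 0" by (simp add: v_def inner_prod_def)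
    then show False using nondeg by (simp add: v_def)
  qed
  have lead_neg: "lead u * q < 0" if u: "u \<noteq> 0" for u
  proof -
    obtain t s where "t > 0" "s > 0" "q = - (t * s * lead u)" using roots[OF u] by blast
    moreover from this have "lead u \<noteq> 0" using q by auto
    ultimately have "lead u * q = - (t * s * (lead u)\<^sup>2)" "t * s * (lead u)\<^sup>2 > 0"
      by (simp add: power2_eq_square, simp)
    then show ?thesis by linarith
  qed
  then show "u \<noteq> 0 \<Longrightarrow> (A (u, 0) \<bullet> (u, 0)) * (A (p, 1) \<bullet> (p, 1)) < 0"
    by (simp add: lead_def q_def)
  show "frontier K = {x. A (x, 1) \<bullet> (x, 1) = 0}"
  proof (intro equalityI subsetI CollectI)
    fix x assume "x \<in> {x. A (x, 1) \<bullet> (x, 1) = 0}"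
    then have x: "A (x, 1) \<bullet> (x, 1) = 0" by simp
    define u where "u = x - p"
    have "u \<noteq> 0" using x q by (auto simp: u_def q_def)
    have one: "q + 2 * lin u + lead u = 0"
      using on_line[of 1 u] x by (simp add: u_def)
    obtain t where t: "t > 0" "p + t *\<^sub>R u \<in> frontier K" "q + 2 * t * lin u + t\<^sup>2 * lead u = 0"
      using hit[OF \<open>u \<noteq> 0\<close>] by blast
    have "(1 - t) * (q - t * lead u) = 0"
      using one t(3) by algebra
    moreover have "q - t * lead u \<noteq> 0"
    proof
      \<comment> \<open>Then \<open>1\<close> and \<open>t\<close> would have the product \<open>q / lead u\<close> of the two roots, which is negative.\<close>
      assume "q - t * lead u = 0"
      then have "lead u * q = t * (lead u)\<^sup>2" by (simp add: power2_eq_square)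
      moreover have "t * (lead u)\<^sup>2 \<ge> 0" using t(1) by simp
      ultimately show False using lead_neg[OF \<open>u \<noteq> 0\<close>] by linarith
    qed
    ultimately have "t = 1" by simp
    then show "x \<in> frontier K" using t(2) by (simp add: u_def)
  qed (use quadric in auto)
qed

text \<open>
  The centre \<open>c\<close> is the point at which the gradient vanishes; definiteness makes the affine map
  \<open>x \<mapsto> fst (A (x, 1))\<close> bijective. Dividing by \<open>- (A (c, 1) \<bullet> (c, 1))\<close> normalises both the constant
  term and the sign of the quadratic part.
\<close>

lemma definite_quadric_eq_ellipsoid:
  fixes A :: "'a::euclidean_space \<times> real \<Rightarrow> 'a \<times> real"
  assumes A: "linear A" and sym: "\<And>X Y. A X \<bullet> Y = A Y \<bullet> X"
    and definite: "\<And>u. u \<noteq> 0 \<Longrightarrow> (A (u, 0) \<bullet> (u, 0)) * (A (p, 1) \<bullet> (p, 1)) < 0"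
    and pq: "A (p, 1) \<bullet> (p, 1) \<noteq> 0"
  obtains P c where "linear P" "\<And>x y. P x \<bullet> y = P y \<bullet> x" "\<And>v. v \<noteq> 0 \<Longrightarrow> v \<bullet> P v > 0"
    "{x. A (x, 1) \<bullet> (x, 1) = 0} = {x. (x - c) \<bullet> P (x - c) = 1}"
proof -
  define L where "L u = fst (A (u, 0))" for u
  have L: "linear L"
  proof (rule linearI)
    show "L (x + y) = L x + L y" for x y
      using linear_add[OF A, of "(x, 0)" "(y, 0)"] by (simp add: L_def)
    show "L (r *\<^sub>R x) = r *\<^sub>R L x" for r x
      using linear_scale[OF A, of r "(x, 0)"] by (simp add: L_def)
  qed
  have L_inner: "A (u, 0) \<bullet> (v, 0) = L u \<bullet> v" for u v
    by (simp add: L_def inner_prod_def)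
  have L_sym: "L x \<bullet> y = L y \<bullet> x" for x y
    using sym[of "(x, 0)" "(y, 0)"] by (simp add: L_inner)
  have "inj L"
    using definite L_inner by (force simp: linear_injective_0[OF L])
  then have "surj L" using linear_injective_imp_surjective[OF L] by blast
  then obtain c where c: "L c = - fst (A (0, 1))" by (metis surjD)
  define k where "k = A (c, 1) \<bullet> (c, 1)"
  have square: "A (x, 1) \<bullet> (x, 1) = k + L (x - c) \<bullet> (x - c)" for x
  proof -
    have X: "(x, 1) = (c, 1) + (x - c, 0::real)" by simp
    have "A (c, 1) = A (c, 0) + A (0, 1)"
      using linear_add[OF A, of "(c, 0)" "(0, 1)"] by simp
    then have "fst (A (c, 1)) = 0" using c by (simp add: L_def)
    then have cross: "A (c, 1) \<bullet> (x - c, 0) = 0" by (simp add: inner_prod_def)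
    show ?thesis
      unfolding X linear_add[OF A] inner_add_left inner_add_right
      using cross sym[of "(x - c, 0)" "(c, 1)"] by (simp add: k_def L_inner)
  qed
  define q where "q = A (p, 1) \<bullet> (p, 1)"
  have neg: "(L u \<bullet> u) * q < 0" if "u \<noteq> 0" for u
    using definite[OF that] by (simp add: L_inner q_def)
  have "q * q > 0" using pq unfolding q_def[symmetric] by (metis not_real_square_gt_zero)
  moreover have "(L (p - c) \<bullet> (p - c)) * q \<le> 0"
    using neg[of "p - c"] by (cases "p = c") (auto simp: less_imp_le)
  moreover have "k = q - L (p - c) \<bullet> (p - c)" using square[of p] by (simp add: q_def)
  ultimately have kq: "k * q > 0" by (simp add: left_diff_distrib)
  define P where "P u = (- 1 / k) *\<^sub>R L u" for u
  have "k \<noteq> 0" using kq by auto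
  have "linear P"
    unfolding P_def by (intro linear_compose_scale_right L)
  moreover have "P x \<bullet> y = P y \<bullet> x" for x y
    using L_sym[of x y] by (simp add: P_def)
  moreover have "v \<bullet> P v > 0" if "v \<noteq> 0" for v
  proof -
    have "(L v \<bullet> v) * k < 0"
      using neg[OF that] kq by (auto simp: mult_less_0_iff zero_less_mult_iff)
    then have "(L v \<bullet> v) / k < 0" by (auto simp: mult_less_0_iff divide_less_0_iff)
    then show ?thesis by (simp add: P_def inner_commute)
  qed
  moreover have "{x. A (x, 1) \<bullet> (x, 1) = 0} = {x. (x - c) \<bullet> P (x - c) = 1}"
    unfolding square P_def inner_scaleR_right inner_commute[of "L _"]
    using \<open>k \<noteq> 0\<close> by (auto simp: field_simps)
  ultimately show ?thesis using that by blast
qed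

section \<open>Ellipsoids from the symmetry of the normal field\<close>

lemma is_ellipsoid_if_linear:
  fixes P :: "real ^ 'n \<Rightarrow> real ^ 'n"
  assumes P: "linear P" and sym: "\<And>x y. P x \<bullet> y = P y \<bullet> x"
    and pos: "\<And>v. v \<noteq> 0 \<Longrightarrow> v \<bullet> P v > 0"
  shows "is_ellipsoid {x. (x - c) \<bullet> P (x - c) = 1}"
proof -
  have works: "matrix P *v v = P v" for v
    using matrix_works[of P v] P by simp
  have "transpose (matrix P) = matrix P"
    using sym[of "axis i 1" "axis j 1" for i j]
    by (simp add: vec_eq_iff transpose_def matrix_def inner_axis)
  then show ?thesis
    unfolding is_ellipsoid_def using pos works by (intro exI[of _ "matrix P"] exI[of _ c]) simp
qed

theorem theorem3:
  fixes S :: "(real ^ 'n) set" and N :: "real ^ 'n \<Rightarrow> real ^ 'n"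
  assumes "CARD('n) \<ge> 2"
    and "smooth_hypersurface S"
    and "closed_strictly_convex_hypersurface S"
    and "normal_field_along S N"
    and "\<forall>x\<in>S. N x \<noteq> 0"
    and "\<forall>x\<in>S. \<forall>y\<in>S. N x \<bullet> (y - x) = - (N y \<bullet> (y - x))"
  shows "is_ellipsoid S"
proof -
  obtain K where K: "strictly_convex_body K" and S: "S = frontier K"
    using assms(3) unfolding closed_strictly_convex_hypersurface_def by blast
  have bd: "bounded K"
    using K compact_imp_bounded unfolding strictly_convex_body_def by blast
  obtain p where p: "p \<in> interior K"
    using K unfolding strictly_convex_body_def by blast
  define M where "M X = (N (fst X), - (N (fst X) \<bullet> fst X))" for X :: "(real ^ 'n) \<times> real"
  have M: "M (x, 1) \<bullet> (y, 1) = N x \<bullet> (y - x)" for x y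
    by (simp add: M_def inner_prod_def inner_diff_right)
  have M_sym: "M X \<bullet> Y = M Y \<bullet> X"
    if X: "X \<in> (\<lambda>x. (x, 1)) ` S" and Y: "Y \<in> (\<lambda>x. (x, 1)) ` S" for X Y
  proof -
    obtain x y where xy: "X = (x, 1)" "Y = (y, 1)" "x \<in> S" "y \<in> S" using X Y by blast
    have "N x \<bullet> (y - x) = N y \<bullet> (x - y)"
      using assms(6) xy by (simp add: inner_diff_right)
    then show ?thesis by (simp add: xy M)
  qed
  obtain A where A: "linear A" and sym: "\<And>X Y. A X \<bullet> Y = A Y \<bullet> X"
    and AM: "\<And>X. X \<in> (\<lambda>x. (x, 1)) ` S \<Longrightarrow> A X = M X"
    using symmetric_pairing_extends[OF span_lifted_frontier[OF bd p, folded S] M_sym] by blast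
  have quadric: "A (x, 1) \<bullet> (x, 1) = 0" if "x \<in> frontier K" for x
    using AM[of "(x, 1)"] that by (simp add: S M)
  obtain z where z: "z \<in> S"
    using ray_to_frontier[OF bd p, of "axis undefined 1"] by (metis S axis_eq_0_iff zero_neq_one)
  have nondeg: "fst (A (z, 1)) \<noteq> 0"
    using AM[of "(z, 1)"] z assms(5) by (simp add: M_def)
  note front = frontier_in_quadric[OF bd p A sym quadric nondeg]
  have "A (p, 1) \<bullet> (p, 1) \<noteq> 0"
    using front(2) p by (auto simp: frontier_def)
  then obtain P c where P: "linear P" "\<And>x y. P x \<bullet> y = P y \<bullet> x" "\<And>v. v \<noteq> 0 \<Longrightarrow> v \<bullet> P v > 0"
    and eq: "{x. A (x, 1) \<bullet> (x, 1) = 0} = {x. (x - c) \<bullet> P (x - c) = 1}"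
    using definite_quadric_eq_ellipsoid[OF A sym front(1)] by blast
  have "S = {x. (x - c) \<bullet> P (x - c) = 1}"
    using S front(2) eq by (rule trans[OF _ trans])
  then show ?thesis
    using is_ellipsoid_if_linear[OF P] by simp
qed

end
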